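(* Let $\mathbf{X}$ be a set of random variables indexed by a finite set $\mathcal{V}$, and for a set of indices $\mathcal{U}\subset\mathcal{V}$ let $\mathbf{X}_\mathcal{U}$ be the corresponding subset of $\mathbf{X}$. Let $\phi$ be a neural network (a deterministic differentiable mapping) mapping $\mathbf{X}$ to $\mathbf{X}_\mathcal{U}$. Then maximizing the mutual information $\mathcal{I}(\mathbf{X};\mathbf{X}_\mathcal{U})$ is equivalent to maximizing the joint entropy $H(\mathbf{X}_\mathcal{U})$; that is, the two maximization problems have the same maximizers.
   Context: The mutual information of random variables $X,Y$ is $\mathcal{I}(X;Y)=D_{KL}(p_{(X,Y)}\,\|\,p_X\otimes p_Y)$, the Kullback--Leibler divergence between the joint law and the product of the marginal laws. $H$ denotes (joint) entropy: for discrete random variables $H(Y)=-\sum_y p_Y(y)\log p_Y(y)$, and for continuous random variables the differential entropy $-\int f_Y(y)\log f_Y(y)\,dy$ with $f_Y$ the probability density function. In the paper $\mathcal{V}$ is the node set of a graph, $\mathbf{X}$ is the family of node signals, and the maximization is over admissible index sets $\mathcal{U}\subset\mathcal{V}$ (the independent sets of the graph), the same constraint set for both problems.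
   Formalization: For continuous variables (nonempty sets with densities) only "entropy maximizers maximize mutual information" is stated; the converse is false there: mutual information is always infinite, e.g. independent uniforms on [0,1] and [0,2]. The equivalence is proved for discrete variables. *)

theory Defs
  imports "HOL-Probability.Probability"
begin

text \<open>
  The library's \<^const>\<open>KL_divergence\<close> is real-valued and takes a default value when the first
  law is not absolutely continuous with respect to the second, or when the integral diverges. Both
  situations matter here, so it is extended by the usual value \<open>\<infinity>\<close>. For probability measures
  \<open>P \<lless> Q\<close> the negative part of the log-density is always \<open>P\<close>-integrable, hence
  non-integrability means divergence to \<open>\<infinity>\<close>. Note that the library writes
  \<open>KL_divergence b Q P\<close> for \<open>D(P \<parallel> Q)\<close>, and that \<open>b\<close> is the base of the logarithm.
\<close>

definition KL_div :: "real \<Rightarrow> 'c measure \<Rightarrow> 'c measure \<Rightarrow> ereal" where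
  "KL_div b P Q =
     (if absolutely_continuous Q P \<and> integrable P (entropy_density b Q P)
      then ereal (KL_divergence b Q P) else \<infinity>)"

definition mutual_info ::
    "real \<Rightarrow> 'a measure \<Rightarrow> 'c measure \<Rightarrow> 'd measure \<Rightarrow> ('a \<Rightarrow> 'c) \<Rightarrow> ('a \<Rightarrow> 'd) \<Rightarrow> ereal" where
  "mutual_info b M S T X Y =
     KL_div b (distr M (S \<Otimes>\<^sub>M T) (\<lambda>\<omega>. (X \<omega>, Y \<omega>))) (distr M S X \<Otimes>\<^sub>M distr M T Y)"

definition discrete_rv :: "'a measure \<Rightarrow> ('a \<Rightarrow> 'c) \<Rightarrow> bool" where
  "discrete_rv M Y \<longleftrightarrow> (\<exists>C. countable C \<and> (AE \<omega> in M. Y \<omega> \<in> C))"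

text \<open>
  Every summand is nonnegative, so the sum is taken as an unsigned integral for the counting
  measure; points that are not atoms contribute \<open>0\<close> because \<open>0 * log b 0 = 0\<close>.
\<close>

definition discrete_entropy :: "real \<Rightarrow> 'a measure \<Rightarrow> ('a \<Rightarrow> 'c) \<Rightarrow> ereal" where
  "discrete_entropy b M Y = enn2ereal (\<integral>\<^sup>+ y.
     (let p = measure M {\<omega> \<in> space M. Y \<omega> = y} in ennreal (- (p * log b p))) \<partial>count_space UNIV)"

text \<open>
  \<open>N\<close> is the reference (Lebesgue) measure and \<open>f\<close> the density of the law of \<open>Y\<close>. The integral of
  \<open>- f log f\<close> is the difference of the integrals of its positive and negative parts, so that the
  values \<open>\<infinity>\<close> and \<open>-\<infinity>\<close> are represented; if both parts are infinite the value is the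
  \<^typ>\<open>ereal\<close> convention \<open>\<infinity> - \<infinity> = \<infinity>\<close>.
\<close>

definition differential_entropy :: "real \<Rightarrow> 'a measure \<Rightarrow> 'c measure \<Rightarrow> ('a \<Rightarrow> 'c) \<Rightarrow> ereal" where
  "differential_entropy b M N Y =
     (let f = (\<lambda>y. enn2real (RN_deriv N (distr M N Y) y)) in
        enn2ereal (\<integral>\<^sup>+ y. ennreal (- (f y * log b (f y))) \<partial>N)
      - enn2ereal (\<integral>\<^sup>+ y. ennreal (f y * log b (f y)) \<partial>N))"

definition joint :: "('v::finite \<Rightarrow> 'a \<Rightarrow> 'b) \<Rightarrow> 'a \<Rightarrow> 'b ^ 'v" where
  "joint X \<omega> = (\<chi> v. X v \<omega>)"

definition subfamily :: "('v \<Rightarrow> 'a \<Rightarrow> 'b) \<Rightarrow> 'v set \<Rightarrow> 'a \<Rightarrow> 'v \<Rightarrow> 'b" where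
  "subfamily X U \<omega> = (\<lambda>v\<in>U. X v \<omega>)"

end

theory Submission
  imports Defs
begin

text \<open>
  Since \<open>Y = X\<^sub>U\<close> is a function of \<open>X\<close>, the joint law of \<open>(X, Y)\<close> lives on a graph. If \<open>Y\<close> is
  discrete with point masses \<open>p y\<close>, that law has density \<open>1 / p y\<close> on the graph with respect to the
  product of the marginals, so the mutual information is the expectation of \<open>- log (p Y)\<close>, the
  entropy. If \<open>Y\<close> has no atoms, the graph is a null set of the product law, so the mutual information
  is \<open>\<infinity>\<close> for every \<open>U\<close>, and every admissible set maximizes it.
\<close>

section \<open>Measurability over countable sets of measurable points\<close>

text \<open>Altering a constant function at countably many measurable points keeps it measurable,
  whatever \<open>h\<close> is. This covers functions of point masses on a general target space
  \<open>T\<close>.\<close>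

lemma measurable_restrict_to_countable:
  assumes "countable C" "\<And>c. c \<in> C \<Longrightarrow> {c} \<in> sets T" "z \<in> space N"
    and "\<And>c. c \<in> C \<Longrightarrow> h c \<in> space N"
  shows "(\<lambda>y. if y \<in> C then h y else z) \<in> measurable T N"
  by (rule measurable_discrete_difference[where f = "\<lambda>_. z" and X = C]) (use assms in auto)

text \<open>Over a countable \<open>C\<close> the graph is a countable union of measurable
  rectangles, one for each value. In a general target space the full graph could fail to be
  measurable.\<close>

lemma graph_over_countable_in_sets:
  assumes "countable C" "\<And>c. c \<in> C \<Longrightarrow> {c} \<in> sets T" "g \<in> measurable S T"
  shows "{(x, y). x \<in> space S \<and> y \<in> C \<and> y = g x} \<in> sets (S \<Otimes>\<^sub>M T)"
proof -
  have "{(x, y). x \<in> space S \<and> y \<in> C \<and> y = g x} = (\<Union>c\<in>C. (g -` {c} \<inter> space S) \<times> {c})"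
    by auto
  also have "\<dots> \<in> sets (S \<Otimes>\<^sub>M T)"
    using assms by (intro sets.countable_UN' pair_measureI measurable_sets) auto
  finally show ?thesis .
qed

context prob_space
begin

section \<open>Point masses and expectations of a discrete variable\<close>

lemma prob_eq_outside_support:
  assumes "AE \<omega> in M. Y \<omega> \<in> C" "y \<notin> C"
  shows "measure M {\<omega> \<in> space M. Y \<omega> = y} = 0"
proof -
  have "AE \<omega> in M. \<not> Y \<omega> = y" using assms(1) by eventually_elim (use assms(2) in auto)
  from emeasure_eq_0_AE[OF this] show ?thesis by (simp add: measure_def)
qed

text \<open>The values of mass zero in the support are at most countably many, so together they are
  still taken with probability zero. This makes \<open>1 / p\<close> and \<open>log b p\<close>
  meaningful almost everywhere.\<close>

lemma AE_prob_eq_pos: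
  assumes Y: "Y \<in> measurable M T" and C: "countable C" "\<And>c. c \<in> C \<Longrightarrow> {c} \<in> sets T"
    and AE_C: "AE \<omega> in M. Y \<omega> \<in> C"
  shows "AE \<omega> in M. 0 < measure M {\<omega>' \<in> space M. Y \<omega>' = Y \<omega>}"
proof -
  let ?p = "\<lambda>y. measure M {\<omega> \<in> space M. Y \<omega> = y}"
  have "AE \<omega> in M. Y \<omega> \<noteq> c" if "c \<in> C" "?p c = 0" for c
  proof (rule AE_I)
    have "{\<omega> \<in> space M. Y \<omega> = c} = Y -` {c} \<inter> space M" by auto
    then show "{\<omega> \<in> space M. Y \<omega> = c} \<in> sets M" using measurable_sets[OF Y C(2)[OF that(1)]] by simp
    show "emeasure M {\<omega> \<in> space M. Y \<omega> = c} = 0" using that(2) by (simp add: emeasure_eq_measure)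
  qed auto
  then have "AE \<omega> in M. \<forall>c\<in>{c \<in> C. ?p c = 0}. Y \<omega> \<noteq> c"
    by (intro AE_ball_countable') (use C(1) in auto)
  with AE_C show ?thesis
    by eventually_elim (auto simp: zero_less_measure_iff)
qed

text \<open>Almost surely \<open>h (Y \<omega>)\<close> is the sum over \<open>c\<close> in
  \<open>C\<close> of \<open>h c\<close> times the indicator of \<open>Y = c\<close>; sum and
  integral are then exchanged. Since only countably many values count, \<open>h\<close> may be
  arbitrary.\<close>

lemma nn_integral_discrete:
  fixes h :: "'c \<Rightarrow> ennreal"
  assumes Y: "Y \<in> measurable M T" and C: "countable C" "\<And>c. c \<in> C \<Longrightarrow> {c} \<in> sets T"
    and AE_C: "AE \<omega> in M. Y \<omega> \<in> C"
  shows "(\<integral>\<^sup>+\<omega>. h (Y \<omega>) \<partial>M) =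
    (\<integral>\<^sup>+y. h y * ennreal (measure M {\<omega> \<in> space M. Y \<omega> = y}) \<partial>count_space UNIV)"
proof -
  let ?E = "\<lambda>c. {\<omega> \<in> space M. Y \<omega> = c}"
  have E: "?E c \<in> sets M" if "c \<in> C" for c
  proof -
    have "?E c = Y -` {c} \<inter> space M" by auto
    then show ?thesis using measurable_sets[OF Y C(2)[OF that]] by simp
  qed
  have "(\<integral>\<^sup>+\<omega>. h (Y \<omega>) \<partial>M) = (\<integral>\<^sup>+\<omega>. \<integral>\<^sup>+c. h c * indicator (?E c) \<omega> \<partial>count_space C \<partial>M)"
  proof (rule nn_integral_cong_AE)
    show "AE \<omega> in M. h (Y \<omega>) = (\<integral>\<^sup>+c. h c * indicator (?E c) \<omega> \<partial>count_space C)"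
      using AE_C AE_space
    proof eventually_elim
      case (elim \<omega>)
      have "(\<integral>\<^sup>+c. h c * indicator (?E c) \<omega> \<partial>count_space C)
          = (\<integral>\<^sup>+c. h c * indicator {Y \<omega>} c \<partial>count_space C)"
        using elim by (intro nn_integral_cong) (auto simp: indicator_def)
      also have "\<dots> = h (Y \<omega>)"
        using elim by (subst nn_integral_indicator_singleton) auto
      finally show ?case by simp
    qed
  qed
  also have "\<dots> = (\<integral>\<^sup>+c. \<integral>\<^sup>+\<omega>. h c * indicator (?E c) \<omega> \<partial>M \<partial>count_space C)"
    using E by (intro nn_integral_count_space_nn_integral C) auto
  also have "\<dots> = (\<integral>\<^sup>+c. h c * ennreal (measure M (?E c)) \<partial>count_space C)"
    using E by (intro nn_integral_cong) (auto simp: nn_integral_cmult_indicator emeasure_eq_measure)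
  \<comment> \<open>Summing over all values instead of \<open>C\<close> changes nothing, as the
    point masses outside the support vanish.\<close>
  also have "\<dots> = (\<integral>\<^sup>+c. h c * ennreal (measure M (?E c)) * indicator C c \<partial>count_space UNIV)"
    by (subst nn_integral_count_space_indicator) auto
  also have "\<dots> = (\<integral>\<^sup>+c. h c * ennreal (measure M (?E c)) \<partial>count_space UNIV)"
    using prob_eq_outside_support[OF AE_C] by (intro nn_integral_cong) (auto simp: indicator_def)
  finally show ?thesis .
qed

section \<open>Discrete case: density of the graph law and its expected logarithm\<close>

text \<open>By Tonelli, integrate over \<open>y\<close> first: for fixed \<open>x\<close> only
  \<open>y = g x\<close> contributes, and there the factor \<open>1 / p\<close> cancels the mass
  that the second marginal gives to this point. What remains is the probability that the pair lies
  in the test set.\<close>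

lemma distr_graph_eq_density:
  fixes g :: "'c \<Rightarrow> 'd"
  assumes X: "X \<in> measurable M S" and g: "g \<in> measurable S T"
    and C: "countable C" "\<And>c. c \<in> C \<Longrightarrow> {c} \<in> sets T" and AE_C: "AE \<omega> in M. g (X \<omega>) \<in> C"
  defines "p \<equiv> \<lambda>y. measure M {\<omega> \<in> space M. g (X \<omega>) = y}"
    and "Q \<equiv> distr M S X \<Otimes>\<^sub>M distr M T (\<lambda>\<omega>. g (X \<omega>))"
  defines "f \<equiv> \<lambda>z. indicator {(x, y). x \<in> space S \<and> y \<in> C \<and> y = g x} z
                  * (if snd z \<in> C then ennreal (1 / p (snd z)) else 0)"
  shows "f \<in> borel_measurable Q"
    and "density Q f = distr M (S \<Otimes>\<^sub>M T) (\<lambda>\<omega>. (X \<omega>, g (X \<omega>)))"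
proof -
  let ?Y = "\<lambda>\<omega>. g (X \<omega>)"
  note [measurable] = X g
  have Y: "?Y \<in> measurable M T" by measurable
  interpret PX: prob_space "distr M S X" by (rule prob_space_distr) fact
  interpret PY: prob_space "distr M T ?Y" by (rule prob_space_distr) fact
  \<comment> \<open>The value 0 off \<open>C\<close> makes \<open>r\<close> and \<open>q\<close>
    measurable. At a point of mass zero both are 0, because \<open>1 / 0 = 0\<close>, so
    \<open>r * q = 1\<close> can hold only almost surely along \<open>?Y\<close>.\<close>
  define r where "r y = (if y \<in> C then ennreal (1 / p y) else 0)" for y
  define q where "q y = (if y \<in> C then ennreal (p y) else 0)" for y
  have [measurable]: "r \<in> borel_measurable T" "q \<in> borel_measurable T"
    unfolding r_def q_def by (intro measurable_restrict_to_countable C; simp)+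
  have [measurable]: "{(x, y). x \<in> space S \<and> y \<in> C \<and> y = g x} \<in> sets (S \<Otimes>\<^sub>M T)"
    by (rule graph_over_countable_in_sets[OF C g])
  have sets_Q[measurable_cong]: "sets Q = sets (S \<Otimes>\<^sub>M T)" unfolding Q_def by measurable
  have f_eq: "f = (\<lambda>z. indicator {(x, y). x \<in> space S \<and> y \<in> C \<and> y = g x} z * r (snd z))"
    unfolding f_def r_def by (rule refl)
  show f[measurable]: "f \<in> borel_measurable Q" unfolding f_eq by measurable
  have "AE \<omega> in M. 0 < p (?Y \<omega>)" unfolding p_def by (rule AE_prob_eq_pos[OF Y C AE_C])
  with AE_C have r_mult_q: "AE \<omega> in M. r (?Y \<omega>) * q (?Y \<omega>) = 1"
    by eventually_elim (simp add: r_def q_def flip: ennreal_mult)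
  show "density Q f = distr M (S \<Otimes>\<^sub>M T) (\<lambda>\<omega>. (X \<omega>, ?Y \<omega>))"
  proof (rule measure_eqI)
    show "sets (density Q f) = sets (distr M (S \<Otimes>\<^sub>M T) (\<lambda>\<omega>. (X \<omega>, ?Y \<omega>)))"
      using sets_Q by simp
    fix A assume "A \<in> sets (density Q f)"
    then have A[measurable]: "A \<in> sets (S \<Otimes>\<^sub>M T)" using sets_Q by simp
    have slice: "(\<integral>\<^sup>+y. f (x, y) * indicator A (x, y) \<partial>distr M T ?Y)
        = r (g x) * q (g x) * indicator A (x, g x)" if "x \<in> space S" for x
    proof -
      have "(\<integral>\<^sup>+y. f (x, y) * indicator A (x, y) \<partial>distr M T ?Y)
          = (\<integral>\<^sup>+y. r (g x) * indicator A (x, g x) * indicator ({g x} \<inter> C) y \<partial>distr M T ?Y)"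
        using that by (intro nn_integral_cong) (auto simp: f_eq indicator_def)
      also have "\<dots> = r (g x) * indicator A (x, g x) * emeasure (distr M T ?Y) ({g x} \<inter> C)"
        using C by (intro nn_integral_cmult_indicator) (cases "g x \<in> C"; simp)
      also have "emeasure (distr M T ?Y) ({g x} \<inter> C) = q (g x)"
      proof (cases "g x \<in> C")
        case True
        have "?Y -` {g x} \<inter> space M = {\<omega> \<in> space M. ?Y \<omega> = g x}" by auto
        with True C(2) show ?thesis
          by (simp add: emeasure_distr[OF Y] q_def p_def emeasure_eq_measure)
      qed (simp add: q_def)
      finally show ?thesis by (simp add: mult_ac)
    qed
    have "emeasure (density Q f) A = (\<integral>\<^sup>+z. f z * indicator A z \<partial>Q)"
      by (rule emeasure_density) (use f A sets_Q in auto)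
    also have "\<dots> = (\<integral>\<^sup>+x. \<integral>\<^sup>+y. f (x, y) * indicator A (x, y) \<partial>distr M T ?Y \<partial>distr M S X)"
      unfolding Q_def by (rule PY.nn_integral_fst[symmetric]) (use Q_def in measurable)
    also have "\<dots> = (\<integral>\<^sup>+x. r (g x) * q (g x) * indicator A (x, g x) \<partial>distr M S X)"
      by (rule nn_integral_cong) (simp add: slice)
    also have "\<dots> = (\<integral>\<^sup>+\<omega>. r (?Y \<omega>) * q (?Y \<omega>) * indicator A (X \<omega>, ?Y \<omega>) \<partial>M)"
      by (rule nn_integral_distr) measurable
    also have "\<dots> = (\<integral>\<^sup>+\<omega>. indicator A (X \<omega>, ?Y \<omega>) \<partial>M)"
      by (rule nn_integral_cong_AE) (use r_mult_q in eventually_elim, simp)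
    also have "\<dots> = (\<integral>\<^sup>+z. indicator A z \<partial>distr M (S \<Otimes>\<^sub>M T) (\<lambda>\<omega>. (X \<omega>, ?Y \<omega>)))"
      by (rule nn_integral_distr[symmetric]) measurable
    also have "\<dots> = emeasure (distr M (S \<Otimes>\<^sub>M T) (\<lambda>\<omega>. (X \<omega>, ?Y \<omega>))) A" by simp
    finally show "emeasure (density Q f) A = emeasure (distr M (S \<Otimes>\<^sub>M T) (\<lambda>\<omega>. (X \<omega>, ?Y \<omega>))) A" .
  qed
qed

text \<open>Along the graph the log-density is \<open>- log b (p (?Y \<omega>))\<close>, whose
  expectation is the entropy. It is nonnegative because \<open>p \<le> 1\<close> and
  \<open>b > 1\<close>, so the equality persists when both sides are infinite.\<close>

lemma mutual_info_graph_eq_discrete_entropy: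
  fixes g :: "'c \<Rightarrow> 'd"
  assumes X: "X \<in> measurable M S" and g: "g \<in> measurable S T"
    and C: "countable C" "\<And>c. c \<in> C \<Longrightarrow> {c} \<in> sets T" and AE_C: "AE \<omega> in M. g (X \<omega>) \<in> C"
    and b: "b > 1"
  shows "mutual_info b M S T X (\<lambda>\<omega>. g (X \<omega>)) = discrete_entropy b M (\<lambda>\<omega>. g (X \<omega>))"
proof -
  let ?Y = "\<lambda>\<omega>. g (X \<omega>)"
  note [measurable] = X g
  have Y: "?Y \<in> measurable M T" by measurable
  interpret PX: prob_space "distr M S X" by (rule prob_space_distr) fact
  interpret PY: prob_space "distr M T ?Y" by (rule prob_space_distr) fact
  interpret PXY: pair_prob_space "distr M S X" "distr M T ?Y" ..
  define p where "p y = measure M {\<omega> \<in> space M. ?Y \<omega> = y}" for y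
  define Q where "Q = distr M S X \<Otimes>\<^sub>M distr M T ?Y"
  define P where "P = distr M (S \<Otimes>\<^sub>M T) (\<lambda>\<omega>. (X \<omega>, ?Y \<omega>))"
  define f where "f z = indicator {(x, y). x \<in> space S \<and> y \<in> C \<and> y = g x} z
                  * (if snd z \<in> C then ennreal (1 / p (snd z)) else 0)" for z
  have f: "f \<in> borel_measurable Q" and dens: "density Q f = P"
    unfolding f_def[abs_def] p_def Q_def P_def by (rule distr_graph_eq_density[OF X g C AE_C]; assumption)+
  have sets_Q[measurable_cong]: "sets Q = sets (S \<Otimes>\<^sub>M T)" unfolding Q_def by measurable
  have ac: "absolutely_continuous Q P" unfolding dens[symmetric] by (rule absolutely_continuousI_density) fact
  \<comment> \<open>Uniqueness of the Radon-Nikodym derivative holds only up to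
    \<open>Q\<close>-null sets; absolute continuity moves it to \<open>P\<close>, and the pair map
    pulls it back to \<open>M\<close>.\<close>
  have "AE z in Q. f z = RN_deriv Q P z"
    using f dens unfolding Q_def by (rule PXY.RN_deriv_unique)
  then have "AE z in P. f z = RN_deriv Q P z"
    by (rule absolutely_continuous_AE[OF _ ac, rotated]) (simp add: P_def sets_Q)
  then have RN: "AE \<omega> in M. f (X \<omega>, ?Y \<omega>) = RN_deriv Q P (X \<omega>, ?Y \<omega>)"
    unfolding P_def by (rule AE_distrD[rotated]) measurable
  let ?d = "entropy_density b Q P"
  have d_meas[measurable]: "?d \<in> borel_measurable (S \<Otimes>\<^sub>M T)"
    using measurable_entropy_density[of b Q P] by (simp cong: measurable_cong_sets add: sets_Q)
  have p_pos: "AE \<omega> in M. 0 < p (?Y \<omega>)" unfolding p_def by (rule AE_prob_eq_pos[OF Y C AE_C])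
  have d_eq: "AE \<omega> in M. ?d (X \<omega>, ?Y \<omega>) = - log b (p (?Y \<omega>)) \<and> 0 \<le> - log b (p (?Y \<omega>))"
    using RN AE_C p_pos AE_space
  proof eventually_elim
    case (elim \<omega>)
    then have pos: "0 < p (?Y \<omega>)" by simp
    have "X \<omega> \<in> space S" using measurable_space[OF X] elim by auto
    then have "f (X \<omega>, ?Y \<omega>) = ennreal (1 / p (?Y \<omega>))" using elim(2) by (simp add: f_def)
    with elim(1) have "RN_deriv Q P (X \<omega>, ?Y \<omega>) = ennreal (1 / p (?Y \<omega>))" by (rule trans[OF sym])
    then have "?d (X \<omega>, ?Y \<omega>) = log b (1 / p (?Y \<omega>))"
      using pos by (simp add: entropy_density_def)
    moreover have "p (?Y \<omega>) \<le> 1" by (simp add: p_def)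
    ultimately show ?case using pos b by (simp add: log_divide)
  qed
  have H: "discrete_entropy b M ?Y = enn2ereal (\<integral>\<^sup>+\<omega>. ennreal (?d (X \<omega>, ?Y \<omega>)) \<partial>M)"
  proof -
    have "(\<integral>\<^sup>+\<omega>. ennreal (?d (X \<omega>, ?Y \<omega>)) \<partial>M) = (\<integral>\<^sup>+\<omega>. ennreal (- log b (p (?Y \<omega>))) \<partial>M)"
      by (rule nn_integral_cong_AE) (use d_eq in eventually_elim, simp)
    also have "\<dots> = (\<integral>\<^sup>+y. ennreal (- log b (p y)) * ennreal (p y) \<partial>count_space UNIV)"
      unfolding p_def by (rule nn_integral_discrete[OF Y C AE_C])
    also have "\<dots> = (\<integral>\<^sup>+y. ennreal (- (p y * log b (p y))) \<partial>count_space UNIV)"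
      by (intro nn_integral_cong) (subst ennreal_mult''[symmetric], auto simp: p_def mult.commute)
    finally show ?thesis by (simp add: discrete_entropy_def p_def Let_def)
  qed
  have pair: "(\<lambda>\<omega>. (X \<omega>, ?Y \<omega>)) \<in> measurable M (S \<Otimes>\<^sub>M T)" by measurable
  have nonneg: "AE \<omega> in M. 0 \<le> ?d (X \<omega>, ?Y \<omega>)" using d_eq by eventually_elim auto
  have int_iff: "integrable P ?d \<longleftrightarrow> integrable M (\<lambda>\<omega>. ?d (X \<omega>, ?Y \<omega>))"
    unfolding P_def using pair d_meas unfolding P_def by (rule integrable_distr_eq)
  have "KL_div b P Q = enn2ereal (\<integral>\<^sup>+\<omega>. ennreal (?d (X \<omega>, ?Y \<omega>)) \<partial>M)"
  proof (cases "integrable P ?d")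
    case True
    then have int: "integrable M (\<lambda>\<omega>. ?d (X \<omega>, ?Y \<omega>))" using int_iff by simp
    have "KL_divergence b Q P = (\<integral>\<omega>. ?d (X \<omega>, ?Y \<omega>) \<partial>M)"
      unfolding KL_divergence_def using integral_distr[OF pair d_meas] by (simp add: P_def)
    then show ?thesis
      using True ac nn_integral_eq_integral[OF int nonneg] integral_nonneg_AE[OF nonneg]
      by (simp add: KL_div_def)
  \<comment> \<open>A nonnegative measurable function that is not integrable has integral
    \<infinity>, which matches the default branch of \<open>KL_div\<close>.\<close>
  next
    case False
    then have "\<not> integrable M (\<lambda>\<omega>. ?d (X \<omega>, ?Y \<omega>))" using int_iff by simp
    then have "(\<integral>\<^sup>+\<omega>. ennreal (?d (X \<omega>, ?Y \<omega>)) \<partial>M) = \<infinity>"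
      using integrableI_nonneg[OF _ nonneg] measurable_compose[OF pair d_meas]
      by (metis infinity_ennreal_def less_top)
    with False show ?thesis by (simp add: KL_div_def)
  qed
  with H show ?thesis by (simp add: mutual_info_def P_def Q_def)
qed

section \<open>Atomless case: singularity of the graph law\<close>

text \<open>Every slice of the graph is a single point, so Fubini makes the graph null for the
  product law, while the joint law gives it mass 1. Absolute continuity fails and
  \<open>KL_div\<close> takes the value \<infinity>.\<close>

lemma mutual_info_graph_atomless:
  fixes g :: "'c \<Rightarrow> 'd"
  assumes X: "X \<in> measurable M S" and g: "g \<in> measurable S T"
    and graph: "{z \<in> space (S \<Otimes>\<^sub>M T). snd z = g (fst z)} \<in> sets (S \<Otimes>\<^sub>M T)"
    and atomless: "\<And>y. y \<in> space T \<Longrightarrow> emeasure (distr M T (\<lambda>\<omega>. g (X \<omega>))) {y} = 0"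
  shows "mutual_info b M S T X (\<lambda>\<omega>. g (X \<omega>)) = \<infinity>"
proof -
  let ?Y = "\<lambda>\<omega>. g (X \<omega>)"
  let ?G = "{z \<in> space (S \<Otimes>\<^sub>M T). snd z = g (fst z)}"
  note [measurable] = X g graph
  have Y: "?Y \<in> measurable M T" by measurable
  have pair: "(\<lambda>\<omega>. (X \<omega>, ?Y \<omega>)) \<in> measurable M (S \<Otimes>\<^sub>M T)" by measurable
  interpret PX: prob_space "distr M S X" by (rule prob_space_distr) fact
  interpret PY: prob_space "distr M T ?Y" by (rule prob_space_distr) fact
  define Q where "Q = distr M S X \<Otimes>\<^sub>M distr M T ?Y"
  define P where "P = distr M (S \<Otimes>\<^sub>M T) (\<lambda>\<omega>. (X \<omega>, ?Y \<omega>))"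
  have sets_Q: "sets Q = sets (S \<Otimes>\<^sub>M T)" unfolding Q_def by measurable
  have "emeasure Q ?G = (\<integral>\<^sup>+x. emeasure (distr M T ?Y) (Pair x -` ?G) \<partial>distr M S X)"
    unfolding Q_def by (rule PY.emeasure_pair_measure_alt) (use graph sets_Q Q_def in auto)
  also have "\<dots> = (\<integral>\<^sup>+x. 0 \<partial>distr M S X)"
  proof (rule nn_integral_cong)
    fix x assume "x \<in> space (distr M S X)"
    then have "x \<in> space S" "g x \<in> space T" using measurable_space[OF g] by auto
    moreover from this have "Pair x -` ?G = {g x}" by (auto simp: space_pair_measure)
    ultimately show "emeasure (distr M T ?Y) (Pair x -` ?G) = 0" using atomless by simp
  qed
  finally have "?G \<in> null_sets Q" using graph sets_Q by (auto simp: null_sets_def)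
  moreover have "emeasure P ?G = 1"
  proof -
    have "(\<lambda>\<omega>. (X \<omega>, ?Y \<omega>)) -` ?G \<inter> space M = space M"
      using measurable_space[OF pair] by auto
    then show ?thesis unfolding P_def using emeasure_distr[OF pair graph] emeasure_space_1 by simp
  qed
  ultimately have "\<not> absolutely_continuous Q P"
    by (auto simp: absolutely_continuous_def null_sets_def)
  then show ?thesis by (simp add: mutual_info_def KL_div_def P_def Q_def)
qed

end

section \<open>Points of finite product spaces and the joint vector\<close>

lemma singleton_in_sets_PiM_borel:
  fixes y :: "'v \<Rightarrow> 'b::t1_space"
  assumes "finite U" "y \<in> extensional U"
  shows "{y} \<in> sets (Pi\<^sub>M U (\<lambda>_. borel))"
proof -
  have "{y} = (\<Pi>\<^sub>E v\<in>U. {y v})" using assms(2) by (auto simp: PiE_iff intro: extensionalityI dest: extensional_arb)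
  also have "\<dots> \<in> sets (Pi\<^sub>M U (\<lambda>_. borel))" using assms(1) by (intro sets_PiM_I_finite) auto
  finally show ?thesis .
qed

text \<open>A point is a box whose sides are points, so its measure is a product of zeros. For
  \<open>U = {}\<close> the product is empty and the only point has measure 1.\<close>

lemma emeasure_PiM_lborel_singleton:
  fixes y :: "'v \<Rightarrow> 'b::euclidean_space"
  assumes "finite U" "U \<noteq> {}" "y \<in> extensional U"
  shows "emeasure (Pi\<^sub>M U (\<lambda>_. lborel)) {y} = 0"
proof -
  interpret product_sigma_finite "\<lambda>_::'v. lborel :: 'b measure" ..
  have "{y} = (\<Pi>\<^sub>E v\<in>U. {y v})" using assms(3) by (auto simp: PiE_iff intro: extensionalityI dest: extensional_arb)
  then show ?thesis using assms emeasure_PiM[OF assms(1), of "\<lambda>v. {y v}"] by auto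
qed

text \<open>The coordinate of the joint vector along the basis vector \<open>axis v u\<close> is the
  coordinate of \<open>X v\<close> along \<open>u\<close>, so measurability can be checked one node
  at a time.\<close>

lemma joint_measurable:
  fixes X :: "'v::finite \<Rightarrow> 'a \<Rightarrow> 'b::euclidean_space"
  assumes "\<And>v. X v \<in> borel_measurable M"
  shows "joint X \<in> borel_measurable M"
proof -
  have "(\<lambda>\<omega>. joint X \<omega> \<bullet> i) \<in> borel_measurable M" if "i \<in> Basis" for i
  proof -
    from that obtain v u where "i = axis v u" by (auto simp: Basis_vec_def)
    then have "(\<lambda>\<omega>. joint X \<omega> \<bullet> i) = (\<lambda>\<omega>. X v \<omega> \<bullet> u)"
      by (simp add: joint_def inner_axis fun_eq_iff)
    then show ?thesis using assms by simp
  qed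
  then show ?thesis by (subst borel_measurable_euclidean_space) auto
qed

lemma vec_nth_borel_measurable [measurable]:
  "(\<lambda>x :: 'b::euclidean_space ^ 'v::finite. x $ v) \<in> borel_measurable borel"
  by (intro borel_measurable_continuous_onI continuous_intros)

text \<open>Exhibits the subfamily as the coordinate projection of the joint vector, the form in
  which the graph lemmas apply.\<close>

lemma subfamily_eq_restrict_joint:
  "subfamily X U = (\<lambda>\<omega>. restrict (($) (joint X \<omega>)) U)"
  by (simp add: subfamily_def joint_def fun_eq_iff)

theorem proposition1:
  fixes M :: "'a measure" and b :: real
    and X :: "'v::finite \<Rightarrow> 'a \<Rightarrow> 'b::euclidean_space"
    and \<A> :: "'v set set"
    and \<phi> :: "'v set \<Rightarrow> 'b ^ 'v \<Rightarrow> 'v \<Rightarrow> 'b"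
  defines "MI \<equiv> \<lambda>U. mutual_info b M borel (Pi\<^sub>M U (\<lambda>_. borel)) (joint X) (subfamily X U)"
    and "H \<equiv> \<lambda>U. discrete_entropy b M (subfamily X U)"
    and "h \<equiv> \<lambda>U. differential_entropy b M (Pi\<^sub>M U (\<lambda>_. lborel)) (subfamily X U)"
  assumes "prob_space M" and "b > 1"
    and "\<And>v. X v \<in> borel_measurable M"
    and "\<And>U v. U \<in> \<A> \<Longrightarrow> v \<in> U \<Longrightarrow> (\<lambda>x. \<phi> U x v) differentiable_on UNIV"
    and "\<And>U. U \<in> \<A> \<Longrightarrow> AE \<omega> in M. \<forall>v\<in>U. subfamily X U \<omega> v = \<phi> U (joint X \<omega>) v"
  shows "((\<forall>v. discrete_rv M (X v)) \<longrightarrow>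
            (\<forall>U. is_arg_max MI (\<lambda>U. U \<in> \<A>) U \<longleftrightarrow> is_arg_max H (\<lambda>U. U \<in> \<A>) U)) \<and>
         ((\<forall>U\<in>\<A>. U \<noteq> {} \<and> (\<exists>f. distributed M (Pi\<^sub>M U (\<lambda>_. lborel)) (subfamily X U) f)) \<longrightarrow>
            (\<forall>U. is_arg_max h (\<lambda>U. U \<in> \<A>) U \<longrightarrow> is_arg_max MI (\<lambda>U. U \<in> \<A>) U))"
proof -
  interpret prob_space M by fact
  have X: "joint X \<in> borel_measurable M" using assms(6) by (rule joint_measurable)
  let ?g = "\<lambda>U (x :: 'b ^ 'v). restrict (($) x) U"
  let ?T = "\<lambda>U. Pi\<^sub>M U (\<lambda>_. borel :: 'b measure)"
  have g: "?g U \<in> measurable borel (?T U)" for U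
    by (rule measurable_restrict) (rule vec_nth_borel_measurable)
  have MI_eq: "MI U = mutual_info b M borel (?T U) (joint X) (\<lambda>\<omega>. ?g U (joint X \<omega>))" for U
    by (simp add: MI_def subfamily_eq_restrict_joint)

  have "MI U = H U" if "\<forall>v. discrete_rv M (X v)" for U
  proof -
    from that obtain D where D: "\<And>v. countable (D v)" "\<And>v. AE \<omega> in M. X v \<omega> \<in> D v"
      unfolding discrete_rv_def by metis
    \<comment> \<open>The node supports combine to the product \<open>Pi\<^sub>E U D\<close>, which
      is countable because \<open>U\<close> is finite.\<close>
    have "AE \<omega> in M. \<forall>v\<in>U. X v \<omega> \<in> D v" by (rule AE_ball_countable') (auto simp: D)
    then have AE_C: "AE \<omega> in M. ?g U (joint X \<omega>) \<in> Pi\<^sub>E U D"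
      by eventually_elim (auto simp: joint_def)
    have "MI U = discrete_entropy b M (\<lambda>\<omega>. ?g U (joint X \<omega>))"
      unfolding MI_eq
    proof (rule mutual_info_graph_eq_discrete_entropy[OF X g _ _ AE_C \<open>b > 1\<close>])
      show "countable (Pi\<^sub>E U D)" by (rule countable_PiE) (auto simp: D)
      show "{c} \<in> sets (?T U)" if "c \<in> Pi\<^sub>E U D" for c
        using that by (intro singleton_in_sets_PiM_borel) (auto simp: PiE_iff)
    qed
    then show ?thesis by (simp add: H_def subfamily_eq_restrict_joint)
  qed
  then have discrete: "MI = H" if "\<forall>v. discrete_rv M (X v)" using that by blast

  have continuous: "MI U = \<infinity>"
    if "U \<noteq> {}" and distrib: "distributed M (Pi\<^sub>M U (\<lambda>_. lborel)) (subfamily X U) f" for U f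
    unfolding MI_eq
  proof (rule mutual_info_graph_atomless[OF X g])
    have sets_eq: "sets (?T U) = sets (Pi\<^sub>M U (\<lambda>_. lborel))" by (intro sets_PiM_cong) auto
    \<comment> \<open>Both sides of the equation are undefined off \<open>U\<close>, so it reduces
      to finitely many coordinate equations, each of them a measurable condition.\<close>
    have "{z \<in> space (borel \<Otimes>\<^sub>M ?T U). snd z = ?g U (fst z)}
        = {z \<in> space (borel \<Otimes>\<^sub>M ?T U). \<forall>v\<in>U. snd z v = fst z $ v}"
      by (force simp: space_pair_measure space_PiM PiE_iff extensional_def fun_eq_iff)
    also have "\<dots> \<in> sets (borel \<Otimes>\<^sub>M ?T U)" by measurable
    finally show "{z \<in> space (borel \<Otimes>\<^sub>M ?T U). snd z = ?g U (fst z)} \<in> sets (borel \<Otimes>\<^sub>M ?T U)" .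
    fix y assume "y \<in> space (?T U)"
    then have y: "y \<in> extensional U" by (auto simp: space_PiM PiE_iff)
    have "{y} \<in> null_sets (Pi\<^sub>M U (\<lambda>_. lborel))"
      using emeasure_PiM_lborel_singleton[OF _ \<open>U \<noteq> {}\<close> y] singleton_in_sets_PiM_borel[OF _ y] sets_eq
      by (auto simp: null_sets_def)
    moreover have "absolutely_continuous (Pi\<^sub>M U (\<lambda>_. lborel)) (density (Pi\<^sub>M U (\<lambda>_. lborel)) f)"
      using distrib by (intro absolutely_continuousI_density) (auto simp: distributed_def)
    ultimately have "emeasure (distr M (Pi\<^sub>M U (\<lambda>_. lborel)) (subfamily X U)) {y} = 0"
      using distributed_distr_eq_density[OF distrib]
      by (auto simp: absolutely_continuous_def null_sets_def)
    \<comment> \<open>The law depends on its target only through the measurable sets, which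
      \<open>lborel\<close> and \<open>borel\<close> share.\<close>
    moreover have "distr M (Pi\<^sub>M U (\<lambda>_. lborel)) (subfamily X U)
        = distr M (?T U) (\<lambda>\<omega>. ?g U (joint X \<omega>))"
      by (rule distr_cong) (auto simp: sets_eq subfamily_eq_restrict_joint)
    ultimately show "emeasure (distr M (?T U) (\<lambda>\<omega>. ?g U (joint X \<omega>))) {y} = 0" by simp
  qed

  show ?thesis
  proof (intro conjI impI)
    show "\<forall>U. is_arg_max MI (\<lambda>U. U \<in> \<A>) U \<longleftrightarrow> is_arg_max H (\<lambda>U. U \<in> \<A>) U"
      if "\<forall>v. discrete_rv M (X v)"
      using discrete[OF that] by simp
    show "\<forall>U. is_arg_max h (\<lambda>U. U \<in> \<A>) U \<longrightarrow> is_arg_max MI (\<lambda>U. U \<in> \<A>) U"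
      if dens: "\<forall>U\<in>\<A>. U \<noteq> {} \<and> (\<exists>f. distributed M (Pi\<^sub>M U (\<lambda>_. lborel)) (subfamily X U) f)"
    proof -
      \<comment> \<open>As \<open>MI\<close> is constant on \<open>\<A>\<close>, no admissible set
        beats another, and every maximizer of \<open>h\<close> is one of \<open>MI\<close>.\<close>
      have "MI U = \<infinity>" if "U \<in> \<A>" for U
        using continuous dens that by blast
      then show ?thesis by (auto simp: is_arg_max_def)
    qed
  qed
qed

end
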